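(* Let $G$ be a compact topological group, let $X$ be a profinite space, and let $\eta: G*X\to X$ be a continuous partial action of $G$ on $X$ such that its domain $G*X$ is closed in $G\times X$. Then the orbit space $X/\!\sim_G$, endowed with the quotient topology, is a profinite space.
   Context: A topological space is profinite if it is homeomorphic to an inverse limit of finite discrete spaces; equivalently, it is compact, Hausdorff and zero-dimensional. A partial action $\eta$ of a group $G$ (with identity $1$) on a set $X$ is a partially defined map $G\times X\to X$, $(g,x)\mapsto g\cdot x$ (write $\exists g\cdot x$ when $g\cdot x$ is defined), such that for all $g,h\in G$, $x\in X$: (PA1) if $\exists g\cdot x$, then $\exists g^{-1}\cdot(g\cdot x)$ and $g^{-1}\cdot(g\cdot x)=x$; (PA2) if $\exists g\cdot(h\cdot x)$, then $\exists (gh)\cdot x$ and $g\cdot(h\cdot x)=(gh)\cdot x$; (PA3) $\exists 1\cdot x$ and $1\cdot x=x$. Put $G*X=\{(g,x)\in G\times X: \exists g\cdot x\}$ (the domain of $\eta$), $X_g=\{x\in X:\exists g^{-1}\cdot x\}$, and $\eta_g:X_{g^{-1}}\to X_g$, $x\mapsto g\cdot x$ (a bijection). When $G$ is a topological group and $X$ a topological space, $G\times X$ has the product topology and $G*X$ the subspace topology; $\eta$ is topological if every $X_g$ is open in $X$ and every $\eta_g$ is a homeomorphism; $\eta$ is a continuous partial action if it is topological and $\eta:G*X\to X$ is continuous. The orbit equivalence relation $\sim_G$ on $X$ is: $x\sim_G y$ if and only if there is $g\in G$ with $\exists g\cdot x$ and $g\cdot x=y$. *)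

theory Defs
  imports "HOL-Analysis.Analysis" "HOL-Algebra.Group"
begin

section \<open>Profinite spaces\<close>

text \<open>Inverse systems of topological spaces \<open>S i\<close> over a directed (preordered) index set \<open>I\<close>,
  with bonding maps \<open>f i j : S j \<rightarrow> S i\<close> for \<open>i \<le> j\<close>.\<close>

definition directed_index :: "'i set \<Rightarrow> ('i \<Rightarrow> 'i \<Rightarrow> bool) \<Rightarrow> bool" where
  "directed_index I leq \<longleftrightarrow>
     I \<noteq> {} \<and>
     (\<forall>i\<in>I. leq i i) \<and>
     (\<forall>i\<in>I. \<forall>j\<in>I. \<forall>k\<in>I. leq i j \<longrightarrow> leq j k \<longrightarrow> leq i k) \<and>
     (\<forall>i\<in>I. \<forall>j\<in>I. \<exists>k\<in>I. leq i k \<and> leq j k)"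

definition inverse_system ::
  "'i set \<Rightarrow> ('i \<Rightarrow> 'i \<Rightarrow> bool) \<Rightarrow> ('i \<Rightarrow> 'b topology) \<Rightarrow> ('i \<Rightarrow> 'i \<Rightarrow> 'b \<Rightarrow> 'b) \<Rightarrow> bool" where
  "inverse_system I leq S f \<longleftrightarrow>
     directed_index I leq \<and>
     (\<forall>i\<in>I. \<forall>j\<in>I. leq i j \<longrightarrow> continuous_map (S j) (S i) (f i j)) \<and>
     (\<forall>i\<in>I. \<forall>x\<in>topspace (S i). f i i x = x) \<and>
     (\<forall>i\<in>I. \<forall>j\<in>I. \<forall>k\<in>I. leq i j \<longrightarrow> leq j k \<longrightarrow>
        (\<forall>x\<in>topspace (S k). f i j (f j k x) = f i k x))"

definition inverse_limit ::
  "'i set \<Rightarrow> ('i \<Rightarrow> 'i \<Rightarrow> bool) \<Rightarrow> ('i \<Rightarrow> 'b topology) \<Rightarrow> ('i \<Rightarrow> 'i \<Rightarrow> 'b \<Rightarrow> 'b) \<Rightarrow> ('i \<Rightarrow> 'b) topology" where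
  "inverse_limit I leq S f =
     subtopology (product_topology S I) {x. \<forall>i\<in>I. \<forall>j\<in>I. leq i j \<longrightarrow> f i j (x j) = x i}"

definition finite_discrete_space :: "'b topology \<Rightarrow> bool" where
  "finite_discrete_space Y \<longleftrightarrow> finite (topspace Y) \<and> Y = discrete_topology (topspace Y)"

text \<open>HOL cannot quantify existentially over types, so the types of the index set and of the points
  of the finite spaces have to be fixed. With the choice below nothing is lost:
  \<open>homeomorphic_inverse_limit_imp_profinite_space\<close> and \<open>profinite_space_iff\<close> show that
  inverse systems over any other types give the same notion.\<close>

definition profinite_space :: "'a topology \<Rightarrow> bool" where
  "profinite_space X \<longleftrightarrow>
     (\<exists>(I :: 'a set set set) leq (S :: 'a set set \<Rightarrow> 'a set topology) f.
        inverse_system I leq S f \<and>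
        (\<forall>i\<in>I. finite_discrete_space (S i)) \<and>
        X homeomorphic_space inverse_limit I leq S f)"

lemma inverse_limit_finite_discrete:
  assumes sys: "inverse_system I leq S f" and fin: "\<And>i. i \<in> I \<Longrightarrow> finite_discrete_space (S i)"
  shows "compact_space (inverse_limit I leq S f)" "Hausdorff_space (inverse_limit I leq S f)"
    "inverse_limit I leq S f dim_le 0"
proof -
  let ?P = "product_topology S I"
  have disc: "S i = discrete_topology (topspace (S i))" if "i \<in> I" for i
    using fin[OF that] by (simp add: finite_discrete_space_def)
  have op: "openin (S i) U \<longleftrightarrow> U \<subseteq> topspace (S i)" if "i \<in> I" for i U
    using disc[OF that] by (metis openin_discrete_topology)
  have cl: "closedin (S i) U \<longleftrightarrow> U \<subseteq> topspace (S i)" if "i \<in> I" for i U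
    using disc[OF that] by (metis closedin_discrete_topology)
  have HS: "Hausdorff_space (S i)" if "i \<in> I" for i
    using disc[OF that] by (metis Hausdorff_space_discrete_topology)
  have CS: "compact_space (S i)" if "i \<in> I" for i
    using disc[OF that] fin[OF that] unfolding finite_discrete_space_def
    by (metis compact_space_discrete_topology)
  have cP: "compact_space ?P" using CS by (simp add: compact_space_product_topology)
  have hP: "Hausdorff_space ?P" using HS by (simp add: Hausdorff_space_product_topology)
  define L where "L = {x. \<forall>i\<in>I. \<forall>j\<in>I. leq i j \<longrightarrow> f i j (x j) = x i}"
  define K where "K i j = {x \<in> topspace ?P. f i j (x j) = x i}" for i j
  have clK: "closedin ?P (K i j)" if "i \<in> I" "j \<in> I" "leq i j" for i j
  proof -
    have pj: "continuous_map ?P (S j) (\<lambda>x. x j)" and pi: "continuous_map ?P (S i) (\<lambda>x. x i)"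
      using that by auto
    have "continuous_map (S j) (S i) (f i j)" using sys that by (simp add: inverse_system_def)
    then have "continuous_map ?P (S i) (\<lambda>x. f i j (x j))"
      using continuous_map_compose[OF pj] by (simp add: o_def)
    then show ?thesis unfolding K_def
      using closedin_continuous_maps_eq[OF HS[OF \<open>i \<in> I\<close>] _ pi] by blast
  qed
  have clL: "closedin ?P (topspace ?P \<inter> L)"
  proof -
    have "topspace ?P \<inter> L =
      topspace ?P \<inter> \<Inter> {K i j |i j. i \<in> I \<and> j \<in> I \<and> leq i j}"
      unfolding L_def K_def by blast
    also have "\<dots> = \<Inter> (insert (topspace ?P) {K i j |i j. i \<in> I \<and> j \<in> I \<and> leq i j})" by simp
    also have "closedin ?P \<dots>"
      by (rule closedin_Inter) (use clK closedin_topspace in blast)+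
    finally show ?thesis .
  qed
  have lim: "inverse_limit I leq S f = subtopology ?P L"
    by (simp add: inverse_limit_def L_def)
  have lim': "subtopology ?P L = subtopology ?P (topspace ?P \<inter> L)"
    by (rule subtopology_restrict[symmetric])
  show "compact_space (inverse_limit I leq S f)"
    unfolding lim lim' using closedin_compact_space[OF cP clL] compact_space_subtopology by blast
  show "Hausdorff_space (inverse_limit I leq S f)"
    unfolding lim by (rule Hausdorff_space_subtopology[OF hP])
  have "?P dim_le 0"
    unfolding dimension_le_0_neighbourhood_base_of_clopen
    unfolding neighbourhood_base_of
  proof (intro allI impI)
    fix W x assume W: "openin ?P W \<and> x \<in> W"
    have "\<exists>U. finite {i \<in> I. U i \<noteq> topspace (S i)} \<and> (\<forall>i\<in>I. openin (S i) (U i)) \<and>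
        x \<in> PiE I U \<and> PiE I U \<subseteq> W"
      using W unfolding openin_product_topology_alt by (elim conjE) (drule (1) bspec)
    then obtain U where U: "finite {i \<in> I. U i \<noteq> topspace (S i)}" "\<forall>i\<in>I. openin (S i) (U i)"
        "x \<in> PiE I U" "PiE I U \<subseteq> W"
      by (elim exE conjE) (rule that)
    have "openin ?P (PiE I U)"
      using U by (simp add: openin_PiE_gen)
    moreover have "closedin ?P (PiE I U)"
      using U(2) by (simp add: closedin_product_topology cl op)
    ultimately show "\<exists>U V. openin ?P U \<and> (closedin ?P V \<and> openin ?P V) \<and> x \<in> U \<and> U \<subseteq> V \<and> V \<subseteq> W"
      using U by blast
  qed
  then show "inverse_limit I leq S f dim_le 0"
    unfolding lim by (rule dimension_le_subtopology)
qed

lemma homeomorphic_inverse_limit_imp: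
  assumes "inverse_system I leq S f" "\<And>i. i \<in> I \<Longrightarrow> finite_discrete_space (S i)"
    and "X homeomorphic_space inverse_limit I leq S f"
  shows "compact_space X \<and> Hausdorff_space X \<and> X dim_le 0"
  using assms inverse_limit_finite_discrete[OF assms(1,2)]
    homeomorphic_compact_space homeomorphic_Hausdorff_space homeomorphic_space_dimension_le
  by metis

lemma compact_Hausdorff_zero_dim_imp_profinite_space:
  fixes X :: "'a topology"
  assumes com: "compact_space X" and haus: "Hausdorff_space X" and dim: "X dim_le 0"
  shows "profinite_space X"
proof -
  define I :: "'a set set set" where
    "I = {P. finite P \<and> (\<forall>C\<in>P. openin X C \<and> C \<noteq> {}) \<and> \<Union>P = topspace X \<and>
             (\<forall>C\<in>P. \<forall>D\<in>P. C \<inter> D \<noteq> {} \<longrightarrow> C = D)}"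
  define leq :: "'a set set \<Rightarrow> 'a set set \<Rightarrow> bool" where "leq P Q \<longleftrightarrow> (\<forall>C\<in>Q. \<exists>D\<in>P. C \<subseteq> D)" for P Q
  define S :: "'a set set \<Rightarrow> 'a set topology" where "S P = discrete_topology P" for P
  define f :: "'a set set \<Rightarrow> 'a set set \<Rightarrow> 'a set \<Rightarrow> 'a set" where
    "f P Q C = (THE D. D \<in> P \<and> C \<subseteq> D)" for P Q C
  have ne: "C \<noteq> {}" if "P \<in> I" "C \<in> P" for P C using that by (auto simp: I_def)
  have opn: "openin X C" if "P \<in> I" "C \<in> P" for P C using that by (auto simp: I_def)
  have cov: "\<Union>P = topspace X" if "P \<in> I" for P using that by (auto simp: I_def)
  have dj: "C = D" if "P \<in> I" "C \<in> P" "D \<in> P" "x \<in> C" "x \<in> D" for P C D x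
    using that unfolding I_def by blast
  have cld: "closedin X C" if "P \<in> I" "C \<in> P" for P C
  proof -
    have "topspace X - C = \<Union>(P - {C})"
    proof (intro equalityI subsetI)
      fix x assume "x \<in> topspace X - C" then show "x \<in> \<Union>(P - {C})"
        using cov[OF that(1)] by blast
    next
      fix x assume "x \<in> \<Union>(P - {C})"
      then obtain D where "D \<in> P" "D \<noteq> C" "x \<in> D" by blast
      then show "x \<in> topspace X - C"
        using cov[OF that(1)] dj[OF that(1) \<open>D \<in> P\<close> that(2)] by blast
    qed
    moreover have "openin X (\<Union>(P - {C}))" using opn[OF that(1)] by blast
    ultimately show ?thesis
      using opn[OF that] by (simp add: closedin_def openin_subset)
  qed
  have fI: "f P Q C = D" if "P \<in> I" "D \<in> P" "C \<subseteq> D" "C \<noteq> {}" for P Q C D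
    unfolding f_def
  proof (rule the_equality)
    show "D \<in> P \<and> C \<subseteq> D" using that by blast
    show "E = D" if E: "E \<in> P \<and> C \<subseteq> E" for E
      using dj[OF \<open>P \<in> I\<close>, of E D] E that \<open>D \<in> P\<close> \<open>C \<subseteq> D\<close> \<open>C \<noteq> {}\<close> by blast
  qed
  have fD: "f P Q C \<in> P \<and> C \<subseteq> f P Q C" if PQ: "P \<in> I" "Q \<in> I" "leq P Q" and C: "C \<in> Q" for P Q C
  proof -
    obtain D where "D \<in> P" "C \<subseteq> D" using PQ C unfolding leq_def by blast
    with fI[OF PQ(1) this ne[OF PQ(2) C], of Q] show ?thesis by simp
  qed
  define cmn where "cmn P Q = {C \<inter> D |C D. C \<in> P \<and> D \<in> Q \<and> C \<inter> D \<noteq> {}}" for P Q :: "'a set set"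
  have cmnI: "cmn P Q \<in> I" if "P \<in> I" "Q \<in> I" for P Q
  proof -
    have fin: "finite (cmn P Q)"
    proof (rule finite_subset)
      show "cmn P Q \<subseteq> (\<lambda>(C,D). C \<inter> D) ` (P \<times> Q)" by (auto simp: cmn_def)
      show "finite ((\<lambda>(C,D). C \<inter> D) ` (P \<times> Q))" using that by (auto simp: I_def)
    qed
    have 1: "\<forall>C\<in>cmn P Q. openin X C \<and> C \<noteq> {}"
      using opn[OF that(1)] opn[OF that(2)] by (auto simp: cmn_def)
    have "\<Union>(cmn P Q) = \<Union>P \<inter> \<Union>Q" unfolding cmn_def by blast
    then have 2: "\<Union>(cmn P Q) = topspace X" using cov that by simp
    have 3: "C = D" if CD: "C \<in> cmn P Q" "D \<in> cmn P Q" "C \<inter> D \<noteq> {}" for C D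
    proof -
      obtain a b where ab: "a \<in> P" "b \<in> Q" "C = a \<inter> b" using CD(1) by (auto simp: cmn_def)
      obtain c d where cd: "c \<in> P" "d \<in> Q" "D = c \<inter> d" using CD(2) by (auto simp: cmn_def)
      obtain x where x: "x \<in> C" "x \<in> D" using CD(3) by blast
      have "a = c" using dj[OF \<open>P \<in> I\<close> ab(1) cd(1)] x ab cd by blast
      moreover have "b = d" using dj[OF \<open>Q \<in> I\<close> ab(2) cd(2)] x ab cd by blast
      ultimately show ?thesis using ab cd by simp
    qed
    show ?thesis unfolding I_def using fin 1 2 3 by blast
  qed
  have cmn_leq: "leq P (cmn P Q)" "leq Q (cmn P Q)" for P Q
    unfolding leq_def cmn_def by blast+
  define cp where "cp U = {U, topspace X - U} - {{}}" for U
  have cpI: "cp U \<in> I" if "closedin X U" "openin X U" for U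
    unfolding I_def cp_def using that openin_subset[OF that(2)] by auto
  have topI: "cp (topspace X) \<in> I" by (rule cpI) auto
  have dirI: "directed_index I leq"
    unfolding directed_index_def
  proof (intro conjI ballI impI)
    show "I \<noteq> {}" using topI by blast
    show "leq P P" for P unfolding leq_def by blast
    show "leq P R" if "leq P Q" "leq Q R" for P Q R using that unfolding leq_def by (meson subset_trans)
    show "\<exists>R\<in>I. leq P R \<and> leq Q R" if "P \<in> I" "Q \<in> I" for P Q
      using cmnI[OF that] cmn_leq[where P=P and Q=Q] by blast
  qed
  have sys: "inverse_system I leq S f"
    unfolding inverse_system_def
  proof (intro conjI ballI impI)
    show "directed_index I leq" by (rule dirI)
    show "continuous_map (S Q) (S P) (f P Q)" if "P \<in> I" "Q \<in> I" "leq P Q" for P Q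
      using fD[OF that] by (auto simp: S_def)
    show "f P P C = C" if "P \<in> I" "C \<in> topspace (S P)" for P C
      using that fI[OF that(1), of C C] ne[OF that(1)] by (simp add: S_def)
    show "f P Q (f Q R C) = f P R C"
      if "P \<in> I" "Q \<in> I" "R \<in> I" "leq P Q" "leq Q R" "C \<in> topspace (S R)" for P Q R C
    proof -
      have C: "C \<in> R" using that by (simp add: S_def)
      note a = fD[OF that(2,3,5) C]
      note b = fD[OF that(1,2,4) conjunct1[OF a]]
      have "C \<subseteq> f P Q (f Q R C)" using a b by blast
      then show ?thesis using fI[OF that(1) conjunct1[OF b] _ ne[OF that(3) C], of R] by simp
    qed
  qed
  have fin: "finite_discrete_space (S P)" if "P \<in> I" for P
    using that by (simp add: finite_discrete_space_def S_def I_def)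
  let ?L = "inverse_limit I leq S f"
  have topL: "x \<in> topspace ?L \<longleftrightarrow> x \<in> PiE I (\<lambda>P. P) \<and> (\<forall>P\<in>I. \<forall>Q\<in>I. leq P Q \<longrightarrow> f P Q (x Q) = x P)" for x
    by (auto simp: inverse_limit_def S_def)
  define cell where "cell P x = (THE C. C \<in> P \<and> x \<in> C)" for P and x :: 'a
  have cellI: "cell P x = C" if "P \<in> I" "C \<in> P" "x \<in> C" for P x C
    unfolding cell_def using that dj by (intro the_equality) blast+
  have cellD: "cell P x \<in> P \<and> x \<in> cell P x" if P: "P \<in> I" and x: "x \<in> topspace X" for P x
  proof -
    obtain C where "C \<in> P" "x \<in> C" using cov[OF P] x by blast
    with cellI[OF P this] show ?thesis by simp
  qed
  define \<phi> where "\<phi> x = (\<lambda>P\<in>I. cell P x)" for x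
  have cont: "continuous_map X ?L \<phi>"
    unfolding inverse_limit_def continuous_map_in_subtopology
  proof (intro conjI)
    show "continuous_map X (product_topology S I) \<phi>"
      unfolding continuous_map_componentwise
    proof (intro conjI ballI)
      show "\<phi> ` topspace X \<subseteq> extensional I" by (auto simp: \<phi>_def)
      fix P assume P: "P \<in> I"
      have "openin X {x \<in> topspace X. cell P x \<in> U}" if "U \<subseteq> P" for U
      proof -
        have "{x \<in> topspace X. cell P x \<in> U} = \<Union>U"
        proof (intro equalityI subsetI)
          fix x assume "x \<in> {x \<in> topspace X. cell P x \<in> U}"
          then show "x \<in> \<Union>U" using cellD[OF P] by blast
        next
          fix x assume "x \<in> \<Union>U"
          then obtain C where C: "C \<in> U" "x \<in> C" by blast
          then have "cell P x = C" using cellI[OF P] that by blast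
          then show "x \<in> {x \<in> topspace X. cell P x \<in> U}" using C that cov[OF P] by blast
        qed
        moreover have "openin X (\<Union>U)" using opn[OF P] that by blast
        ultimately show ?thesis by simp
      qed
      then show "continuous_map X (S P) (\<lambda>x. \<phi> x P)"
        using P cellD[OF P] by (auto simp: continuous_map_def S_def \<phi>_def)
    qed
    show "\<phi> \<in> topspace X \<rightarrow> {x. \<forall>P\<in>I. \<forall>Q\<in>I. leq P Q \<longrightarrow> f P Q (x Q) = x P}"
    proof (intro Pi_I CollectI ballI impI)
      fix x P Q assume x: "x \<in> topspace X" and P: "P \<in> I" and Q: "Q \<in> I" and "leq P Q"
      note c = cellD[OF Q x] 
      note d = fD[OF P Q \<open>leq P Q\<close> conjunct1[OF c]]
      have "cell P x = f P Q (cell Q x)" using cellI[OF P conjunct1[OF d]] c d by blast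
      then show "f P Q (\<phi> x Q) = \<phi> x P" by (simp add: \<phi>_def P Q)
    qed
  qed
  have inj: "inj_on \<phi> (topspace X)"
  proof (rule inj_onI, rule ccontr)
    fix x y assume x: "x \<in> topspace X" and y: "y \<in> topspace X" and eq: "\<phi> x = \<phi> y" and "x \<noteq> y"
    obtain W W' where W: "openin X W" "openin X W'" "x \<in> W" "y \<in> W'" "disjnt W W'"
      using haus[unfolded Hausdorff_space_def, rule_format, of x y] x y \<open>x \<noteq> y\<close> by auto
    then have yW: "y \<notin> W" by (auto simp: disjnt_def)
    obtain U V where U: "openin X U" "closedin X V" "openin X V" "x \<in> U" "U \<subseteq> V" "V \<subseteq> W"
      using dim[unfolded dimension_le_0_neighbourhood_base_of_clopen neighbourhood_base_of,
          rule_format, of W x] W(1,3) by blast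
    have xV: "x \<in> V" and yV: "y \<notin> V" using U yW by auto
    have c: "cp V \<in> I" using U cpI by blast
    have "cell (cp V) x = V" using cellI[OF c, of V x] xV by (auto simp: cp_def)
    moreover have "cell (cp V) x = cell (cp V) y" using fun_cong[OF eq, of "cp V"] c by (simp add: \<phi>_def)
    ultimately show False using cellD[OF c y] yV by simp
  qed
  have surj: "topspace ?L \<subseteq> \<phi> ` topspace X"
  proof
    fix z assume "z \<in> topspace ?L"
    then have z: "z \<in> PiE I (\<lambda>P. P)" and zc: "\<And>P Q. P \<in> I \<Longrightarrow> Q \<in> I \<Longrightarrow> leq P Q \<Longrightarrow> f P Q (z Q) = z P"
      unfolding topL by auto
    have zin: "z P \<in> P" if "P \<in> I" for P using z that by auto
    have dirF: "\<exists>Q\<in>I. z Q \<subseteq> \<Inter>(z ` J)" if "finite J" "J \<subseteq> I" for J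
      using that
    proof (induction J rule: finite_induct)
      case empty then show ?case using topI by auto
    next
      case (insert P J)
      then obtain Q where Q: "Q \<in> I" "z Q \<subseteq> \<Inter>(z ` J)" by auto
      have P: "P \<in> I" using insert by auto
      let ?M = "cmn P Q"
      have M: "?M \<in> I" using cmnI P Q by blast
      have "z ?M \<subseteq> f P ?M (z ?M)" "z ?M \<subseteq> f Q ?M (z ?M)"
        using fD[OF P M cmn_leq(1) zin[OF M]] fD[OF Q(1) M cmn_leq(2) zin[OF M]] by auto
      then have sub: "z ?M \<subseteq> z P" "z ?M \<subseteq> z Q"
        using zc[OF P M cmn_leq(1)] zc[OF Q(1) M cmn_leq(2)] by (simp_all only:)
      have "z ?M \<subseteq> \<Inter>(z ` insert P J)"
        unfolding image_insert Inter_insert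
        by (rule Int_greatest[OF sub(1) subset_trans[OF sub(2) Q(2)]])
      then show ?case using M by blast
    qed
    have "\<Inter>F \<noteq> {}" if F: "finite F" "F \<subseteq> z ` I" for F
    proof -
      obtain J where J: "finite J" "J \<subseteq> I" "F = z ` J" using finite_subset_image[OF F] by blast
      obtain Q where Q: "Q \<in> I" "z Q \<subseteq> \<Inter>F" using dirF[OF J(1,2)] J(3) by blast
      then show ?thesis using ne[OF Q(1) zin[OF Q(1)]] by blast
    qed
    moreover have "\<forall>C\<in>z ` I. closedin X C" using cld zin by blast
    ultimately have "\<Inter>(z ` I) \<noteq> {}"
      using com[unfolded compact_space_fip, rule_format, of "z ` I"] by blast
    then obtain x where x: "x \<in> \<Inter>(z ` I)" by blast
    have xX: "x \<in> topspace X" using x topI zin[OF topI] cov[OF topI] by blast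
    have "\<phi> x = z"
    proof
      fix P show "\<phi> x P = z P"
      proof (cases "P \<in> I")
        case True
        then have "x \<in> z P" using x by blast
        then show ?thesis using cellI[OF True zin[OF True]] True by (simp add: \<phi>_def)
      next
        case False
        then show ?thesis using PiE_arb[OF z False] by (simp add: \<phi>_def)
      qed
    qed
    then show "z \<in> \<phi> ` topspace X" using xX by blast
  qed
  have "homeomorphic_map X ?L \<phi>"
  proof (rule continuous_imp_homeomorphic_map)
    show "\<phi> ` topspace X = topspace ?L" using surj continuous_map_image_subset_topspace[OF cont] by blast
    show "Hausdorff_space ?L" by (rule inverse_limit_finite_discrete(2)[OF sys fin])
  qed (use com cont inj in auto)
  then have "X homeomorphic_space ?L" using homeomorphic_map_imp_homeomorphic_space by blast
  then show ?thesis unfolding profinite_space_def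
    by (intro exI[of _ I] exI[of _ leq] exI[of _ S] exI[of _ f] conjI ballI sys fin)
qed

theorem profinite_space_iff:
  fixes X :: "'a topology"
  shows "profinite_space X \<longleftrightarrow> compact_space X \<and> Hausdorff_space X \<and> X dim_le 0" (is "_ \<longleftrightarrow> ?R")
proof
  assume "profinite_space X"
  then obtain I :: "'a set set set" and leq and S :: "'a set set \<Rightarrow> 'a set topology" and f
    where "inverse_system I leq S f"
      "\<forall>i\<in>I. finite_discrete_space (S i)" "X homeomorphic_space inverse_limit I leq S f"
    unfolding profinite_space_def by blast
  then show ?R
    using homeomorphic_inverse_limit_imp by blast
qed (blast intro: compact_Hausdorff_zero_dim_imp_profinite_space)

theorem homeomorphic_inverse_limit_imp_profinite_space:
  fixes I :: "'i set" and S :: "'i \<Rightarrow> 'b topology"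
  assumes "inverse_system I leq S f" "\<And>i. i \<in> I \<Longrightarrow> finite_discrete_space (S i)"
    and "X homeomorphic_space inverse_limit I leq S f"
  shows "profinite_space X"
  using homeomorphic_inverse_limit_imp[OF assms] by (simp add: profinite_space_iff)


section \<open>Quotient spaces\<close>

text \<open>The points of the quotient by an equivalence relation \<open>r\<close> are the \<open>r\<close>-classes; the preimage
  of a set \<open>U\<close> of classes under the projection is \<open>\<Union>U\<close>.\<close>

definition quotient_topology :: "'a topology \<Rightarrow> ('a \<times> 'a) set \<Rightarrow> 'a set topology" where
  "quotient_topology X r = topology (\<lambda>U. U \<subseteq> topspace X // r \<and> openin X (\<Union>U))"

lemma openin_quotient_topology:
  assumes "equiv (topspace X) r"
  shows "openin (quotient_topology X r) U \<longleftrightarrow> U \<subseteq> topspace X // r \<and> openin X (\<Union>U)"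
proof -
  have "istopology (\<lambda>U. U \<subseteq> topspace X // r \<and> openin X (\<Union>U))"
    unfolding istopology_def
  proof (intro conjI allI impI)
    fix U V assume UV: "U \<subseteq> topspace X // r \<and> openin X (\<Union>U)" "V \<subseteq> topspace X // r \<and> openin X (\<Union>V)"
    have "\<Union>(U \<inter> V) = \<Union>U \<inter> \<Union>V"
    proof (intro equalityI subsetI)
      fix x assume "x \<in> \<Union>U \<inter> \<Union>V"
      then obtain C D where "C \<in> U" "D \<in> V" "x \<in> C" "x \<in> D" by blast
      moreover have "C = D"
        using quotient_disj[OF assms, of C D] UV calculation by blast
      ultimately show "x \<in> \<Union>(U \<inter> V)" by blast
    qed blast
    then show "openin X (\<Union>(U \<inter> V))" using UV by (metis openin_Int)
    show "U \<inter> V \<subseteq> topspace X // r" using UV by blast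
  next
    fix K assume K: "\<forall>U\<in>K. U \<subseteq> topspace X // r \<and> openin X (\<Union>U)"
    then show "\<Union>K \<subseteq> topspace X // r" by blast
    have "\<Union>(\<Union>K) = \<Union>(Union ` K)" by blast
    then show "openin X (\<Union>(\<Union>K))" using K by (metis (no_types, lifting) imageE openin_Union)
  qed
  then show ?thesis by (simp add: quotient_topology_def)
qed

lemma topspace_quotient_topology:
  assumes "equiv (topspace X) r"
  shows "topspace (quotient_topology X r) = topspace X // r"
proof -
  have "openin (quotient_topology X r) (topspace X // r)"
    by (simp add: openin_quotient_topology[OF assms] Union_quotient[OF assms])
  then show ?thesis
    by (metis assms openin_quotient_topology openin_subset openin_topspace subset_antisym)
qed

lemma quotient_map_quotient_topology:
  assumes r: "equiv (topspace X) r"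
  shows "quotient_map X (quotient_topology X r) (\<lambda>x. r `` {x})"
  unfolding quotient_map_def topspace_quotient_topology[OF r]
proof (intro conjI allI impI)
  show "(\<lambda>x. r `` {x}) ` topspace X = topspace X // r" by (auto simp: quotient_def)
  fix U assume U: "U \<subseteq> topspace X // r"
  have "{x \<in> topspace X. r `` {x} \<in> U} = \<Union>U"
  proof (intro equalityI subsetI)
    fix x assume "x \<in> {x \<in> topspace X. r `` {x} \<in> U}"
    then show "x \<in> \<Union>U" using equiv_class_self[OF r] by blast
  next
    fix x assume "x \<in> \<Union>U"
    then obtain C where C: "C \<in> U" "x \<in> C" by blast
    then obtain y where y: "y \<in> topspace X" "C = r `` {y}" using U by (auto simp: quotient_def)
    then have "C = r `` {x}" using equiv_class_eq[OF r] C by blast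
    moreover have "x \<in> topspace X" using C y r by (auto simp: equiv_def refl_on_def)
    ultimately show "x \<in> {x \<in> topspace X. r `` {x} \<in> U}" using C by blast
  qed
  then show "openin X {x \<in> topspace X. r `` {x} \<in> U} \<longleftrightarrow> openin (quotient_topology X r) U"
    by (simp add: openin_quotient_topology[OF r] U)
qed


section \<open>Topological groups and continuous partial actions\<close>

text \<open>No separation axiom is imposed on a topological group.\<close>

locale topological_group = group G for G :: "('g, 'm) monoid_scheme" (structure) +
  fixes T :: "'g topology"
  assumes topspace_eq_carrier: "topspace T = carrier G"
    and continuous_mult: "continuous_map (prod_topology T T) T (\<lambda>(g, h). g \<otimes> h)"
    and continuous_inv: "continuous_map T T (\<lambda>g. inv g)"

text \<open>The partially defined map is an option-valued function: \<open>act g x = Some y\<close> means that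
  \<open>g \<cdot> x\<close> is defined and equal to \<open>y\<close>.\<close>

locale partial_action = group G for G :: "('g, 'm) monoid_scheme" (structure) +
  fixes A :: "'a set" and act :: "'g \<Rightarrow> 'a \<Rightarrow> 'a option"
  assumes act_typed: "act g x = Some y \<Longrightarrow> g \<in> carrier G \<and> x \<in> A \<and> y \<in> A"
    and PA1: "act g x = Some y \<Longrightarrow> act (inv g) y = Some x"
    and PA2: "act h x = Some y \<Longrightarrow> act g y = Some z \<Longrightarrow> act (g \<otimes> h) x = Some z"
    and PA3: "x \<in> A \<Longrightarrow> act \<one> x = Some x"

definition pact_domain :: "('g, 'm) monoid_scheme \<Rightarrow> 'a set \<Rightarrow> ('g \<Rightarrow> 'a \<Rightarrow> 'a option) \<Rightarrow> ('g \<times> 'a) set" where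
  "pact_domain G A act = {(g, x). g \<in> carrier G \<and> x \<in> A \<and> act g x \<noteq> None}"

text \<open>The set \<open>X\<^sub>g\<close>, which is the range of the partial bijection given by \<open>g\<close>.\<close>

definition pact_range :: "('g, 'm) monoid_scheme \<Rightarrow> 'a set \<Rightarrow> ('g \<Rightarrow> 'a \<Rightarrow> 'a option) \<Rightarrow> 'g \<Rightarrow> 'a set" where
  "pact_range G A act g = {x \<in> A. act (inv\<^bsub>G\<^esub> g) x \<noteq> None}"

definition topological_partial_action ::
  "('g, 'm) monoid_scheme \<Rightarrow> 'a topology \<Rightarrow> ('g \<Rightarrow> 'a \<Rightarrow> 'a option) \<Rightarrow> bool" where
  "topological_partial_action G X act \<longleftrightarrow>
     partial_action G (topspace X) act \<and>
     (\<forall>g\<in>carrier G.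
        openin X (pact_range G (topspace X) act g) \<and>
        homeomorphic_map
          (subtopology X (pact_range G (topspace X) act (inv\<^bsub>G\<^esub> g)))
          (subtopology X (pact_range G (topspace X) act g))
          (\<lambda>x. the (act g x)))"

definition continuous_partial_action ::
  "('g, 'm) monoid_scheme \<Rightarrow> 'g topology \<Rightarrow> 'a topology \<Rightarrow> ('g \<Rightarrow> 'a \<Rightarrow> 'a option) \<Rightarrow> bool" where
  "continuous_partial_action G T X act \<longleftrightarrow>
     topological_partial_action G X act \<and>
     continuous_map (subtopology (prod_topology T X) (pact_domain G (topspace X) act)) X
       (\<lambda>(g, x). the (act g x))"

definition orbit_rel :: "('g, 'm) monoid_scheme \<Rightarrow> 'a set \<Rightarrow> ('g \<Rightarrow> 'a \<Rightarrow> 'a option) \<Rightarrow> ('a \<times> 'a) set" where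
  "orbit_rel G A act = {(x, y). x \<in> A \<and> y \<in> A \<and> (\<exists>g\<in>carrier G. act g x = Some y)}"

lemma (in partial_action) equiv_orbit_rel: "equiv A (orbit_rel G A act)"
proof (rule equivI)
  show "orbit_rel G A act \<subseteq> A \<times> A" by (auto simp: orbit_rel_def)
  show "refl_on A (orbit_rel G A act)"
    using PA3 by (fastforce simp: refl_on_def orbit_rel_def)
  show "sym (orbit_rel G A act)"
    using PA1 by (fastforce simp: sym_def orbit_rel_def)
  show "trans (orbit_rel G A act)"
    unfolding trans_def orbit_rel_def using PA2 m_closed by blast
qed

end

theory Submission
  imports Defs
begin

text \<open>
  A profinite space is the same as a compact, Hausdorff, zero-dimensional space, and the projection
  \<open>q\<close> of \<open>X\<close> onto the orbit space carries all three properties over because it is open and closed.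

  It is open for every topological partial action: the saturation of an open set is the union of its
  translates under the partial homeomorphisms \<open>\<eta>\<^sub>g\<close>, whose ranges are open. This is
  \<open>openin_orbit_saturation\<close>. It is closed because \<open>G\<close> is compact and \<open>G*X\<close> is closed: orbits being
  symmetric, the saturation of \<open>F\<close> is the projection to \<open>X\<close> of \<open>\<eta>\<^sup>-\<^sup>1(F)\<close>, which is closed in
  \<open>G*X\<close> and hence in \<open>G \<times> X\<close>, and projecting along a compact factor is a closed map. This is
  \<open>closedin_orbit_saturation\<close>.

  So \<open>q\<close> sends clopen sets to clopen sets, and the images of the clopen neighbourhoods of a point
  form a neighbourhood base at its orbit; and points of the orbit space are closed, being images of
  points of \<open>X\<close>. Compactness is inherited by any continuous image, and a zero-dimensional space
  with closed points is Hausdorff (\<open>profinite_space_open_closed_map_image\<close>).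
\<close>

text \<open>Pull a neighbourhood of \<open>q x\<close> back to \<open>X\<close>, shrink it to a clopen neighbourhood of \<open>x\<close>, and
  push that forward: openness keeps the image a neighbourhood, and both assumptions on \<open>q\<close> together
  keep it clopen.\<close>

lemma zero_dimensional_open_closed_map_image:
  assumes dim: "X dim_le 0" and cont: "continuous_map X Y q" and surj: "q ` topspace X = topspace Y"
    and opn: "open_map X Y q" and cls: "closed_map X Y q"
  shows "Y dim_le 0"
  unfolding dimension_le_0_neighbourhood_base_of_clopen neighbourhood_base_of
proof (intro allI impI)
  fix W y assume W: "openin Y W \<and> y \<in> W"
  then have "y \<in> q ` topspace X" using surj openin_subset by blast
  then obtain x where x: "x \<in> topspace X" "y = q x" by blast
  have "openin X {x \<in> topspace X. q x \<in> W}"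
    using cont W openin_continuous_map_preimage by blast
  moreover have "x \<in> {x \<in> topspace X. q x \<in> W}" using x W by blast
  ultimately obtain U V where UV: "openin X U" "closedin X V" "openin X V" "x \<in> U" "U \<subseteq> V"
      "V \<subseteq> {x \<in> topspace X. q x \<in> W}"
    using dim[unfolded dimension_le_0_neighbourhood_base_of_clopen neighbourhood_base_of,
        rule_format, of "{x \<in> topspace X. q x \<in> W}" x] by blast
  have "openin Y (q ` U)" "openin Y (q ` V)" "closedin Y (q ` V)"
    using UV opn cls by (auto simp: open_map_def closed_map_def)
  moreover have "y \<in> q ` U" "q ` U \<subseteq> q ` V" "q ` V \<subseteq> W" using UV x by auto
  ultimately show "\<exists>U V. openin Y U \<and> (closedin Y V \<and> openin Y V) \<and> y \<in> U \<and> U \<subseteq> V \<and> V \<subseteq> W"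
    by blast
qed

text \<open>Hausdorffness does not pass to quotients directly; it is recovered from the image being
  zero-dimensional, hence regular, with closed points.\<close>

lemma profinite_space_open_closed_map_image:
  assumes X: "profinite_space X" and cont: "continuous_map X Y q"
    and surj: "q ` topspace X = topspace Y" and opn: "open_map X Y q" and cls: "closed_map X Y q"
  shows "profinite_space Y"
proof -
  have com: "compact_space X" and haus: "Hausdorff_space X" and dim: "X dim_le 0"
    using X by (simp_all add: profinite_space_iff)
  have "compact_space Y"
    using com cont surj by (metis compact_space_def image_compactin)
  moreover have dimY: "Y dim_le 0"
    by (rule zero_dimensional_open_closed_map_image[OF dim cont surj opn cls])
  moreover have "t1_space Y"
    using t1_space_closed_map_image[OF cls surj Hausdorff_imp_t1_space[OF haus]] .
  then have "Hausdorff_space Y"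
    using zero_dimensional_imp_regular_space[OF dimY] regular_t1_imp_Hausdorff_space by blast
  ultimately show ?thesis by (simp add: profinite_space_iff)
qed

text \<open>The preimage under the projection of the image of \<open>U\<close> is the saturation \<open>r `` U\<close>, so
  openness and closedness of the projection can be tested on saturations.\<close>

lemma
  assumes r: "equiv (topspace X) r"
  shows open_map_quotient_topology:
      "(\<And>U. openin X U \<Longrightarrow> openin X (r `` U)) \<Longrightarrow> open_map X (quotient_topology X r) (\<lambda>x. r `` {x})"
    and closed_map_quotient_topology:
      "(\<And>F. closedin X F \<Longrightarrow> closedin X (r `` F)) \<Longrightarrow> closed_map X (quotient_topology X r) (\<lambda>x. r `` {x})"
proof -
  let ?q = "\<lambda>x. r `` {x}"
  note q = quotient_map_quotient_topology[OF r]
  have pre: "{x \<in> topspace X. ?q x \<in> ?q ` U} = r `` U" if "U \<subseteq> topspace X" for U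
  proof (intro equalityI subsetI)
    fix x assume "x \<in> {x \<in> topspace X. ?q x \<in> ?q ` U}"
    then obtain u where u: "u \<in> U" "r `` {x} = r `` {u}" and x: "x \<in> topspace X" by blast
    then have "(u, x) \<in> r" using equiv_class_self[OF r x] by blast
    then show "x \<in> r `` U" using u by blast
  next
    fix x assume "x \<in> r `` U"
    then obtain u where u: "u \<in> U" "(u, x) \<in> r" by blast
    then have "r `` {x} = r `` {u}" using equiv_class_eq[OF r] by metis
    moreover have "x \<in> topspace X" using u(2) r by (auto simp: equiv_def)
    ultimately show "x \<in> {x \<in> topspace X. ?q x \<in> ?q ` U}" using u by blast
  qed
  have im: "?q ` U \<subseteq> topspace (quotient_topology X r)" if "U \<subseteq> topspace X" for U
    using that by (auto simp: topspace_quotient_topology[OF r] quotient_def)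
  show "open_map X (quotient_topology X r) ?q" if sat: "\<And>U. openin X U \<Longrightarrow> openin X (r `` U)"
    unfolding open_map_def
  proof (intro allI impI)
    fix U assume U: "openin X U"
    note sub = openin_subset[OF U]
    have "openin X {x \<in> topspace X. ?q x \<in> ?q ` U}" using sat[OF U] pre[OF sub] by simp
    then show "openin (quotient_topology X r) (?q ` U)"
      using q im[OF sub] unfolding quotient_map_def by blast
  qed
  show "closed_map X (quotient_topology X r) ?q" if sat: "\<And>F. closedin X F \<Longrightarrow> closedin X (r `` F)"
    unfolding closed_map_def
  proof (intro allI impI)
    fix F assume F: "closedin X F"
    note sub = closedin_subset[OF F]
    have "closedin X {x \<in> topspace X. ?q x \<in> ?q ` F}" using sat[OF F] pre[OF sub] by simp
    then show "closedin (quotient_topology X r) (?q ` F)"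
      using q im[OF sub] unfolding quotient_map_closedin by blast
  qed
qed

text \<open>The saturation of \<open>U\<close> is the union of the translates \<open>g \<cdot> (X\<^bsub>g\<inverse>\<^esub> \<inter> U)\<close>. Each translate is open
  in \<open>X\<^sub>g\<close>, and being open in \<open>X\<close> itself depends on \<open>X\<^sub>g\<close> being open.\<close>

lemma openin_orbit_saturation:
  assumes act: "topological_partial_action G X act" and U: "openin X U"
  shows "openin X (orbit_rel G (topspace X) act `` U)"
proof -
  interpret partial_action G "topspace X" act
    using act by (simp add: topological_partial_action_def)
  let ?R = "pact_range G (topspace X) act"
  let ?tr = "\<lambda>g. (\<lambda>x. the (act g x)) ` (?R (inv\<^bsub>G\<^esub> g) \<inter> U)"
  have tr: "openin X (?tr g)" if g: "g \<in> carrier G" for g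
  proof -
    have R: "openin X (?R g)"
      and "homeomorphic_map (subtopology X (?R (inv\<^bsub>G\<^esub> g))) (subtopology X (?R g)) (\<lambda>x. the (act g x))"
      using act g unfolding topological_partial_action_def by blast+
    then have "open_map (subtopology X (?R (inv\<^bsub>G\<^esub> g))) (subtopology X (?R g)) (\<lambda>x. the (act g x))"
      using homeomorphic_imp_open_map by blast
    moreover have "openin (subtopology X (?R (inv\<^bsub>G\<^esub> g))) (?R (inv\<^bsub>G\<^esub> g) \<inter> U)"
      using U by (rule openin_subtopology_Int2)
    ultimately have "openin (subtopology X (?R g)) (?tr g)" unfolding open_map_def by blast
    then show ?thesis using R by (rule openin_trans_full)
  qed
  have "orbit_rel G (topspace X) act `` U = (\<Union>g\<in>carrier G. ?tr g)"
  proof (intro equalityI subsetI)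
    fix y assume "y \<in> orbit_rel G (topspace X) act `` U"
    then obtain x g where "x \<in> U" "g \<in> carrier G" "act g x = Some y" "x \<in> topspace X"
      by (auto simp: orbit_rel_def)
    then show "y \<in> (\<Union>g\<in>carrier G. ?tr g)"
      by (force simp: pact_range_def)
  next
    fix y assume "y \<in> (\<Union>g\<in>carrier G. ?tr g)"
    then obtain g x where g: "g \<in> carrier G" and x: "x \<in> U" "act g x = Some y"
      by (auto simp: pact_range_def)
    then show "y \<in> orbit_rel G (topspace X) act `` U"
      using act_typed[OF x(2)] by (auto simp: orbit_rel_def)
  qed
  then show ?thesis using tr by auto
qed

text \<open>A union of translates, as used for open sets, need not be closed when \<open>G\<close> is infinite. Instead,
  since the orbit relation is symmetric, \<open>x\<close> lies in the saturation of \<open>F\<close> iff some \<open>g\<close> moves \<open>x\<close>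
  into \<open>F\<close>, that is, iff \<open>x\<close> is the second component of a point of \<open>\<eta>\<^sup>-\<^sup>1(F)\<close>; the projection
  \<open>G \<times> X \<rightarrow> X\<close> is a closed map by compactness of \<open>G\<close>.\<close>

lemma closedin_orbit_saturation:
  assumes com: "compact_space T" and act: "continuous_partial_action G T X act"
    and dom: "closedin (prod_topology T X) (pact_domain G (topspace X) act)"
    and F: "closedin X F"
  shows "closedin X (orbit_rel G (topspace X) act `` F)"
proof -
  interpret partial_action G "topspace X" act
    using act by (simp add: continuous_partial_action_def topological_partial_action_def)
  let ?D = "pact_domain G (topspace X) act"
  let ?r = "orbit_rel G (topspace X) act"
  let ?S = "subtopology (prod_topology T X) ?D"
  let ?P = "{p \<in> topspace ?S. (\<lambda>(g, x). the (act g x)) p \<in> F}"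
  have D: "?D \<subseteq> topspace (prod_topology T X)" using dom by (rule closedin_subset)
  have "closedin ?S ?P"
    using act F closedin_continuous_map_preimage unfolding continuous_partial_action_def by blast
  then have "closedin (prod_topology T X) ?P" using dom by (rule closedin_trans_full)
  then have "closedin X (snd ` ?P)"
    using closed_map_snd[OF com, of X] unfolding closed_map_def by blast
  moreover have "snd ` ?P = ?r `` F"
  proof (intro equalityI subsetI)
    fix x assume "x \<in> snd ` ?P"
    then obtain g y where g: "g \<in> carrier G" "act g x = Some y" "y \<in> F"
      by (auto simp: pact_domain_def)
    then have "(x, y) \<in> ?r" using act_typed[OF g(2)] by (auto simp: orbit_rel_def)
    then have "(y, x) \<in> ?r" using equiv_orbit_rel by (meson equiv_def symD)
    then show "x \<in> ?r `` F" using g by blast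
  next
    fix x assume "x \<in> ?r `` F"
    then obtain y where y: "y \<in> F" "(y, x) \<in> ?r" by blast
    then have "(x, y) \<in> ?r" using equiv_orbit_rel by (meson equiv_def symD)
    then obtain g where g: "g \<in> carrier G" "act g x = Some y" "x \<in> topspace X"
      by (auto simp: orbit_rel_def)
    then have "(g, x) \<in> ?D" by (simp add: pact_domain_def)
    then have "(g, x) \<in> ?P" using D g y by auto
    then show "x \<in> snd ` ?P" by force
  qed
  ultimately show ?thesis by simp
qed

theorem theorem3p2:
  fixes G :: "('g, 'm) monoid_scheme" and T :: "'g topology"
    and X :: "'a topology" and act :: "'g \<Rightarrow> 'a \<Rightarrow> 'a option"
  assumes "topological_group G T" and "compact_space T"
    and "profinite_space X"
    and "continuous_partial_action G T X act"
    and "closedin (prod_topology T X) (pact_domain G (topspace X) act)"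
  shows "profinite_space (quotient_topology X (orbit_rel G (topspace X) act))"
proof -
  have top: "topological_partial_action G X act"
    using assms(4) by (simp add: continuous_partial_action_def)
  then interpret partial_action G "topspace X" act
    by (simp add: topological_partial_action_def)
  note q = quotient_map_quotient_topology[OF equiv_orbit_rel]
  show ?thesis
  proof (rule profinite_space_open_closed_map_image[OF assms(3)])
    show "continuous_map X (quotient_topology X (orbit_rel G (topspace X) act))
        (\<lambda>x. orbit_rel G (topspace X) act `` {x})"
      using q by (rule quotient_imp_continuous_map)
    show "(\<lambda>x. orbit_rel G (topspace X) act `` {x}) ` topspace X =
        topspace (quotient_topology X (orbit_rel G (topspace X) act))"
      using q by (rule quotient_imp_surjective_map)
  qed (intro open_map_quotient_topology closed_map_quotient_topology equiv_orbit_rel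
      openin_orbit_saturation[OF top] closedin_orbit_saturation[OF assms(2,4,5)]; assumption)+
qed

end
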